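(* Let $\alpha,\beta\in\mathbb{R}$ and $\boldsymbol{x}=(x_1,\dots,x_n)\in\mathbb{R}^n$. Then $$S_k(\boldsymbol{x})^2\geq S_{k-1}(\boldsymbol{x})\,S_{k+1}(\boldsymbol{x}),\qquad k=3,4,\dots,n-1.$$ For each such $k$ the inequality is strict unless $x_1=x_2=\cdots=x_n$, or unless both sides of the inequality are $0$, or unless $$\frac{S_k(\boldsymbol{x})}{S_{k-1}(\boldsymbol{x})}=\frac{S_{k+1}(\boldsymbol{x})}{S_k(\boldsymbol{x})}=-\alpha=-\beta.$$ Further, let $k\in\{2,3,\dots,n\}$. If $\alpha,\beta\geq 0$, $E_1(\boldsymbol{x})\geq 0$, $E_2(\boldsymbol{x})\geq 0$, and $S_m(\boldsymbol{x})\geq 0$ for all $m=3,4,\dots,k$, then $$S_1(\boldsymbol{x})\geq S_2(\boldsymbol{x})^{1/2}\geq\cdots\geq S_k(\boldsymbol{x})^{1/k}.$$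
   Context: For $\boldsymbol{x}=(x_1,\dots,x_n)\in\mathbb{R}^n$, let $\sigma_k(\boldsymbol{x})=\sum_{1\leq i_1<\cdots<i_k\leq n}x_{i_1}\cdots x_{i_k}$ for $1\le k\le n$ be the $k$-th elementary symmetric function, and let $E_k(\boldsymbol{x})=\sigma_k(\boldsymbol{x})/\binom{n}{k}$ be its normalized mean. Conventions: $E_0(\boldsymbol{x})=1$, and $E_k(\boldsymbol{x})=0$ if $k<0$ or $k>n$. For $\alpha,\beta\in\mathbb{R}$ define $$S_k(\boldsymbol{x})=E_k(\boldsymbol{x})+(\alpha+\beta)E_{k-1}(\boldsymbol{x})+\alpha\beta\,E_{k-2}(\boldsymbol{x}).$$
   Formalization: In the third exceptional case, "= -α = -β" is replaced by "= -α or = -β": as printed the strictness claim is false (n=4, k=3, x=(0,1,1,1), α=-1, β=0 gives S_2=S_3=S_4=-1/4, so equality holds with common ratio 1 = -α ≠ -β). *)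

theory Defs
  imports "HOL-Analysis.Analysis"
begin

text \<open>Index tuples \<open>i\<^sub>1 < \<dots> < i\<^sub>k\<close> are represented by the \<open>k\<close>-element subsets of the index type.\<close>

definition elem_sym :: "nat \<Rightarrow> real ^ 'n \<Rightarrow> real" where
  "elem_sym k x = (\<Sum>I | I \<subseteq> UNIV \<and> card I = k. \<Prod>i\<in>I. x $ i)"

text \<open>The index is an integer, so that \<open>E\<^sub>-\<^sub>1 = 0\<close> is available as a genuine value;
  \<open>E\<^sub>0 = 1\<close> comes from the empty product.\<close>

definition elem_mean :: "int \<Rightarrow> real ^ 'n \<Rightarrow> real" where
  "elem_mean k x =
     (if 0 \<le> k \<and> k \<le> int CARD('n)
      then elem_sym (nat k) x / real (CARD('n) choose nat k) else 0)"

definition lin_mean :: "real \<Rightarrow> real \<Rightarrow> int \<Rightarrow> real ^ 'n \<Rightarrow> real" where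
  "lin_mean \<alpha> \<beta> k x =
     elem_mean k x + (\<alpha> + \<beta>) * elem_mean (k - 1) x + \<alpha> * \<beta> * elem_mean (k - 2) x"

lemma elem_mean_0: "elem_mean 0 (x :: real ^ 'n) = 1"
proof -
  have "{I :: 'n set. I \<subseteq> UNIV \<and> card I = 0} = {{}}"
    by auto
  then show ?thesis
    by (simp add: elem_mean_def elem_sym_def)
qed

end

theory Submission
  imports Defs "HOL-Computational_Algebra.Fundamental_Theorem_Algebra"
begin

text \<open>
  The polynomial \<open>\<Prod> (X + x\<^sub>i) = \<Sum> (n choose j) E\<^sub>j X\<^bsup>n-j\<^esup>\<close> has only real roots. For
  \<open>p\<^sub>m = \<Sum> (m choose j) e\<^sub>j X\<^bsup>m-j\<^esup>\<close>, ordinary differentiation lowers \<open>m\<close> and keeps \<open>e\<close>, whereas the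
  polar derivative with pole \<open>a\<close> lowers \<open>m\<close> and replaces \<open>e\<^sub>j\<close> by \<open>e\<^sub>j\<^sub>+\<^sub>1 + a e\<^sub>j\<close>. Both preserve
  real-rootedness. Applying derivatives, polar derivatives with pole \<open>0\<close> and those with poles \<open>\<alpha>\<close>
  and \<open>\<beta>\<close>, one arrives at the quadratic \<open>S\<^sub>k\<^sub>-\<^sub>1 X\<^sup>2 + 2 S\<^sub>k X + S\<^sub>k\<^sub>+\<^sub>1\<close>, whose discriminant is
  therefore nonnegative. If it vanishes, the double root either is one of the poles or lifts, step by
  step, to a root of full multiplicity of the original polynomial.
\<close>

section \<open>Appell polynomials and polar derivatives\<close>

definition appell_poly :: "nat \<Rightarrow> (nat \<Rightarrow> real) \<Rightarrow> complex poly" where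
  "appell_poly m e = (\<Sum>i\<le>m. monom (complex_of_real (real (m choose i) * e (m - i))) i)"

text \<open>The degree of \<open>appell_poly m e\<close> may drop below \<open>m\<close> (roots at infinity), and the zero
  polynomial is admitted; this is what makes the property stable under polar derivatives.\<close>

definition real_rooted :: "nat \<Rightarrow> (nat \<Rightarrow> real) \<Rightarrow> bool" where
  "real_rooted m e \<longleftrightarrow> (\<forall>z. Im z \<noteq> 0 \<longrightarrow> appell_poly m e \<noteq> 0 \<longrightarrow> poly (appell_poly m e) z \<noteq> 0)"

definition polar :: "real \<Rightarrow> (nat \<Rightarrow> real) \<Rightarrow> nat \<Rightarrow> real" where
  "polar a e j = e (Suc j) + a * e j"

text \<open>Equivalently, \<open>appell_poly m e\<close> is a nonzero multiple of (X + q)^m. Since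
  0^0 = 1, \<open>q = 0\<close> means that the terms after \<open>e 0\<close> vanish.\<close>

definition geometric_upto :: "nat \<Rightarrow> real \<Rightarrow> (nat \<Rightarrow> real) \<Rightarrow> bool" where
  "geometric_upto m q e \<longleftrightarrow> e 0 \<noteq> 0 \<and> (\<forall>j\<le>m. e j = e 0 * q ^ j)"

lemma coeff_appell_poly:
  "coeff (appell_poly m e) i = (if i \<le> m then of_real (real (m choose i) * e (m - i)) else 0)"
  by (simp add: appell_poly_def coeff_sum if_distrib cong: if_cong)

lemma degree_appell_poly: "degree (appell_poly m e) \<le> m"
  by (rule degree_le) (simp add: coeff_appell_poly)

lemma poly_appell_poly:
  "poly (appell_poly m e) z = (\<Sum>i\<le>m. of_real (real (m choose i) * e (m - i)) * z ^ i)"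
  by (simp add: appell_poly_def poly_sum poly_monom)

lemma appell_poly_eq_0_iff: "appell_poly m e = 0 \<longleftrightarrow> (\<forall>j\<le>m. e j = 0)"
proof
  assume *: "appell_poly m e = 0"
  show "\<forall>j\<le>m. e j = 0"
  proof (intro allI impI)
    fix j assume "j \<le> m"
    then show "e j = 0"
      using coeff_appell_poly[of m e "m - j"] * by auto
  qed
qed (simp add: poly_eq_iff coeff_appell_poly)

lemma appell_poly_cong:
  assumes "\<And>j. j \<le> m \<Longrightarrow> e j = f j"
  shows "appell_poly m e = appell_poly m f"
  using assms by (simp add: poly_eq_iff coeff_appell_poly)

lemma pderiv_appell_poly:
  "pderiv (appell_poly (Suc m) e) = smult (of_nat (Suc m)) (appell_poly m e)"
proof (rule poly_eqI)
  fix i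
  have "real (Suc i) * real (Suc m choose Suc i) = real (Suc m) * real (m choose i)"
    unfolding of_nat_mult[symmetric] Suc_times_binomial ..
  then have "real (Suc i) * (real (Suc m choose Suc i) * e (m - i))
      = real (Suc m) * (real (m choose i) * e (m - i))"
    by (simp only: mult.assoc[symmetric])
  from arg_cong[OF this, of complex_of_real]
  show "coeff (pderiv (appell_poly (Suc m) e)) i = coeff (smult (of_nat (Suc m)) (appell_poly m e)) i"
    by (simp add: coeff_pderiv coeff_appell_poly del: binomial_Suc_Suc)
qed

text \<open>Up to a factor, the right-hand side is the polar derivative
  \<open>(m + 1) p - (X - a) p'\<close> of \<open>p = appell_poly (Suc m) e\<close>.\<close>

lemma appell_poly_polar:
  "appell_poly m (polar a e) = appell_poly (Suc m) e - [:- of_real a, 1:] * appell_poly m e"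
proof (rule poly_eqI)
  fix i
  show "coeff (appell_poly m (polar a e)) i
    = coeff (appell_poly (Suc m) e - [:- of_real a, 1:] * appell_poly m e) i"
  proof (cases i)
    case 0
    then show ?thesis
      by (simp add: coeff_appell_poly polar_def)
  next
    case (Suc k)
    consider "Suc k \<le> m" | "k = m" | "k > m" by linarith
    then show ?thesis
    proof cases
      case 1
      then have "Suc (m - Suc k) = m - k" by simp
      with Suc 1 show ?thesis
        by (simp add: coeff_appell_poly polar_def algebra_simps)
    qed (use Suc in \<open>simp_all add: coeff_appell_poly polar_def\<close>)
  qed
qed

section \<open>Roots of derivatives and polar derivatives\<close>

lemma real_root_factorization:
  fixes p :: "complex poly"
  assumes "\<And>z. poly p z = 0 \<Longrightarrow> Im z = 0"
  obtains r where "p = smult (lead_coeff p) (\<Prod>i<degree p. [:- complex_of_real (r i), 1:])"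
proof -
  obtain root where root: "smult (lead_coeff p) (\<Prod>i<degree p. [:- root i, 1:]) = p"
    by (rule complex_poly_decompose')
  have "root i = of_real (Re (root i))" if "i < degree p" for i
  proof -
    have "poly p (root i) = 0"
      by (subst root[symmetric]) (use that in \<open>auto simp: poly_prod\<close>)
    then show ?thesis using assms by (simp add: complex_eq_iff)
  qed
  then have "(\<Prod>i<degree p. [:- root i, 1:]) = (\<Prod>i<degree p. [:- complex_of_real (Re (root i)), 1:])"
    by (intro prod.cong) auto
  then show thesis using that[of "Re \<circ> root"] root by simp
qed

lemma poly_pderiv_prod_linear:
  fixes z :: "'a :: field"
  assumes "\<And>i. i \<in> A \<Longrightarrow> z \<noteq> r i" "finite A"
  shows "poly (pderiv (\<Prod>i\<in>A. [:- r i, 1:])) z = (\<Prod>i\<in>A. z - r i) * (\<Sum>i\<in>A. 1 / (z - r i))"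
proof -
  have "(\<Prod>j\<in>A - {i}. z - r j) = (\<Prod>j\<in>A. z - r j) * (1 / (z - r i))" if "i \<in> A" for i
    using assms that by (simp add: prod.remove)
  then show ?thesis
    by (simp add: pderiv_prod poly_sum poly_prod sum_distrib_left pderiv_pCons)
qed

text \<open>Gauss-Lucas for the real line: p'/p is the sum of 1 / (z - r_i), and all summands have
  imaginary part of sign opposite to Im z, so nothing cancels.\<close>

lemma poly_pderiv_nonreal:
  fixes p :: "complex poly"
  assumes real: "\<And>z. poly p z = 0 \<Longrightarrow> Im z = 0" and "pderiv p \<noteq> 0" and z: "Im z \<noteq> 0"
  shows "poly (pderiv p) z \<noteq> 0"
proof -
  obtain r where r: "p = smult (lead_coeff p) (\<Prod>i<degree p. [:- complex_of_real (r i), 1:])"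
    using real_root_factorization real by blast
  have zr: "z \<noteq> of_real (r i)" for i using z by auto
  \<comment> \<open>At least one root is needed for the sum of inverse squares to be strictly
    positive.\<close>
  have deg: "degree p > 0"
    using assms(2) by (metis gr0I pderiv_eq_0_iff)
  have pd: "poly (pderiv p) z = lead_coeff p * ((\<Prod>i<degree p. z - of_real (r i))
      * (\<Sum>i<degree p. 1 / (z - of_real (r i))))"
    by (subst r) (simp add: pderiv_smult poly_pderiv_prod_linear zr)
  have "Im (\<Sum>i<degree p. 1 / (z - of_real (r i)))
      = - Im z * (\<Sum>i<degree p. 1 / (cmod (z - of_real (r i)))\<^sup>2)"
    by (simp add: sum_distrib_left Im_divide cmod_power2 flip: sum_negf)
  moreover have "(\<Sum>i<degree p. 1 / (cmod (z - of_real (r i)))\<^sup>2) > 0"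
    using deg zr by (intro sum_pos) auto
  ultimately have "Im (\<Sum>i<degree p. 1 / (z - of_real (r i))) \<noteq> 0"
    using z by (metis less_irrefl mult_eq_0_iff neg_equal_0_iff_equal)
  then have "(\<Sum>i<degree p. 1 / (z - of_real (r i))) \<noteq> 0"
    by (metis zero_complex.sel(2))
  then show ?thesis
    unfolding pd using zr deg by auto
qed

text \<open>With \<open>y = z - a\<close> and real roots \<open>r\<^sub>i\<close> of \<open>p\<close>, the polar derivative at \<open>z\<close> is \<open>p z\<close> times
  \<open>(n - d) + \<Sum> (a - r\<^sub>i) / (z - r\<^sub>i)\<close>; after multiplication by \<open>y\<close>, all imaginary parts of the summands
  have the sign of \<open>Im z\<close>.\<close>

lemma poly_polar_nonreal:
  fixes p :: "complex poly" and a :: real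
  assumes real: "\<And>z. poly p z = 0 \<Longrightarrow> Im z = 0" and deg: "degree p \<le> n"
    and nz: "smult (of_nat n) p - [:- of_real a, 1:] * pderiv p \<noteq> 0" and z: "Im z \<noteq> 0"
  shows "poly (smult (of_nat n) p - [:- of_real a, 1:] * pderiv p) z \<noteq> 0"
proof
  define d where "d = degree p"
  obtain r where "p = smult (lead_coeff p) (\<Prod>i<degree p. [:- complex_of_real (r i), 1:])"
    using real_root_factorization real by blast
  then have r: "p = smult (lead_coeff p) (\<Prod>i<d. [:- complex_of_real (r i), 1:])"
    unfolding d_def .
  define y where "y = z - of_real a"
  have zr: "z - of_real (r i) \<noteq> 0" for i using z by (auto simp: complex_eq_iff)
  have pz: "poly p z \<noteq> 0" using real z by auto
  have pd: "poly (pderiv p) z = poly p z * (\<Sum>i<d. 1 / (z - of_real (r i)))"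
  proof -
    have "poly (pderiv p) z = lead_coeff p * ((\<Prod>i<d. z - of_real (r i))
        * (\<Sum>i<d. 1 / (z - of_real (r i))))"
      by (subst r) (use zr in \<open>simp add: pderiv_smult poly_pderiv_prod_linear\<close>)
    moreover have "poly p z = lead_coeff p * (\<Prod>i<d. z - of_real (r i))"
      by (subst r) (simp add: poly_prod)
    ultimately show ?thesis by simp
  qed
  have fac: "poly (smult (of_nat n) p - [:- of_real a, 1:] * pderiv p) z
      = poly p z * (of_nat n - y * (\<Sum>i<d. 1 / (z - of_real (r i))))"
    by (simp add: pd y_def algebra_simps)
  assume "poly (smult (of_nat n) p - [:- of_real a, 1:] * pderiv p) z = 0"
  then have "of_nat n - y * (\<Sum>i<d. 1 / (z - of_real (r i))) = 0"
    using fac pz by simp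
  moreover have "y * (\<Sum>i<d. 1 / (z - of_real (r i)))
      = of_nat d - (\<Sum>i<d. of_real (a - r i) / (z - of_real (r i)))"
  proof -
    have "y / (z - of_real (r i)) = 1 - of_real (a - r i) / (z - of_real (r i))" for i
      using zr[of i] by (simp add: y_def field_simps)
    then show ?thesis by (simp add: sum_distrib_left sum_subtractf)
  qed
  ultimately have "of_real (real (n - d)) + (\<Sum>i<d. of_real (a - r i) / (z - of_real (r i))) = 0"
    using deg by (simp add: d_def of_nat_diff algebra_simps)
  then have "0 = Im (y * (of_real (real (n - d)) + (\<Sum>i<d. of_real (a - r i) / (z - of_real (r i)))))"
    by simp
  also have "\<dots> = Im z * (real (n - d) + (\<Sum>i<d. (a - r i)\<^sup>2 / (cmod (z - of_real (r i)))\<^sup>2))"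
  proof -
    have "Im (y * (of_real (a - r i) / (z - of_real (r i))))
        = Im z * ((a - r i)\<^sup>2 / (cmod (z - of_real (r i)))\<^sup>2)" for i
    proof -
      have "(Re z - r i)\<^sup>2 + (Im z)\<^sup>2 > 0"
        using z by (simp add: sum_power2_gt_zero_iff)
      then show ?thesis
        unfolding cmod_power2
        by (simp add: y_def Im_divide field_simps) (simp add: power2_eq_square algebra_simps)
    qed
    then show ?thesis
      by (simp add: distrib_left sum_distrib_left y_def)
  qed
  finally have *: "real (n - d) + (\<Sum>i<d. (a - r i)\<^sup>2 / (cmod (z - of_real (r i)))\<^sup>2) = 0"
    using z by simp
  \<comment> \<open>Only the degenerate case survives: n = d and all roots equal a. Then p is a
    multiple of (X - a)^n and its polar derivative vanishes identically, against
    \<open>nz\<close>.\<close>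
  have ge: "(\<Sum>i<d. (a - r i)\<^sup>2 / (cmod (z - of_real (r i)))\<^sup>2) \<ge> 0"
    by (intro sum_nonneg) auto
  then have "(\<Sum>i<d. (a - r i)\<^sup>2 / (cmod (z - of_real (r i)))\<^sup>2) = 0" and "n = d"
    using * deg d_def by auto
  then have "r i = a" if "i < d" for i
    using that zr[of i] by (subst (asm) sum_nonneg_eq_0_iff) auto
  then have "p = smult (lead_coeff p) ([:- of_real a, 1:] ^ d)"
    by (subst r) simp
  then have "smult (of_nat d) p - [:- of_real a, 1:] * pderiv p = 0"
  proof -
    assume p: "p = smult (lead_coeff p) ([:- of_real a, 1:] ^ d)"
    have "[:- complex_of_real a, 1:] * pderiv ([:- of_real a, 1:] ^ d)
        = smult (of_nat d) ([:- of_real a, 1:] ^ d)"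
    proof (cases d)
      case (Suc k)
      have "pderiv [:- complex_of_real a, 1:] = 1"
        by (simp add: pderiv_pCons)
      then show ?thesis
        unfolding Suc pderiv_power_Suc by (simp del: mult_pCons_left mult_pCons_right of_nat_Suc)
    qed simp
    then have "[:- of_real a, 1:] * pderiv p = smult (of_nat d) p"
      by (subst (1 2) p)
        (simp add: pderiv_smult mult.commute del: mult_pCons_left mult_pCons_right)
    then show ?thesis by simp
  qed
  with nz \<open>n = d\<close> show False by simp
qed

lemma real_rooted_Suc:
  assumes "real_rooted (Suc m) e"
  shows "real_rooted m e"
proof (cases "appell_poly (Suc m) e = 0")
  case True
  then show ?thesis
    by (simp add: real_rooted_def appell_poly_eq_0_iff)
next
  case False
  show ?thesis
    unfolding real_rooted_def
  proof (intro allI impI)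
    fix z assume z: "Im z \<noteq> 0" "appell_poly m e \<noteq> 0"
    have "poly (pderiv (appell_poly (Suc m) e)) z \<noteq> 0"
      by (rule poly_pderiv_nonreal)
        (use z False assms in \<open>auto simp: real_rooted_def pderiv_appell_poly simp del: of_nat_Suc\<close>)
    then show "poly (appell_poly m e) z \<noteq> 0"
      by (simp add: pderiv_appell_poly)
  qed
qed

lemma real_rooted_polar:
  assumes "real_rooted (Suc m) e"
  shows "real_rooted m (polar a e)"
proof (cases "appell_poly (Suc m) e = 0")
  case True
  then show ?thesis
    by (simp add: real_rooted_def appell_poly_eq_0_iff polar_def)
next
  case False
  let ?p = "appell_poly (Suc m) e"
  have eq: "smult (of_nat (Suc m)) ?p - [:- of_real a, 1:] * pderiv ?p
      = smult (of_nat (Suc m)) (appell_poly m (polar a e))"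
    by (simp add: pderiv_appell_poly appell_poly_polar smult_diff_right del: of_nat_Suc)
  show ?thesis
    unfolding real_rooted_def
  proof (intro allI impI)
    fix z assume z: "Im z \<noteq> 0" "appell_poly m (polar a e) \<noteq> 0"
    have "poly (smult (of_nat (Suc m)) ?p - [:- of_real a, 1:] * pderiv ?p) z \<noteq> 0"
      by (rule poly_polar_nonreal)
        (use z False assms degree_appell_poly eq in
          \<open>auto simp: real_rooted_def simp del: of_nat_Suc\<close>)
    then show "poly (appell_poly m (polar a e)) z \<noteq> 0"
      unfolding eq by simp
  qed
qed

section \<open>Multiple roots\<close>

text \<open>There are n distinct complex n-th roots of c, and at most two of them are real.\<close>

lemma exists_nonreal_nth_root:
  fixes c :: real
  assumes "c \<noteq> 0" "n \<ge> 3"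
  obtains w where "Im w \<noteq> 0" "w ^ n = complex_of_real c"
proof (rule ccontr)
  assume no: "\<not> thesis"
  have "{w. w ^ n = complex_of_real c} \<subseteq> {of_real (root n \<bar>c\<bar>), - of_real (root n \<bar>c\<bar>)}"
  proof
    fix w assume "w \<in> {w. w ^ n = complex_of_real c}"
    then have w: "w ^ n = complex_of_real c" by simp
    with no that have "Im w = 0" by blast
    then obtain t where t: "w = of_real t"
      by (metis complex_is_Real_iff Reals_cases)
    with w have "t ^ n = c"
      by (metis of_real_eq_iff of_real_power)
    then have "\<bar>t\<bar> = root n \<bar>c\<bar>"
      using assms by (intro real_root_pos_unique[symmetric]) (auto simp: power_abs)
    with w t show "w \<in> {of_real (root n \<bar>c\<bar>), - of_real (root n \<bar>c\<bar>)}"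
      by (auto simp: abs_if split: if_splits)
  qed
  then have "card {w. w ^ n = complex_of_real c} \<le> 2"
    by (rule order_trans[OF card_mono, rotated]) (auto intro: card_insert_le_m1)
  then show False
    using card_nth_roots[of "complex_of_real c" n] assms by simp
qed

lemma poly_appell_poly_geometric:
  "poly (appell_poly m (\<lambda>j. a * u ^ j + b * v ^ j)) z
    = of_real a * (z + of_real u) ^ m + of_real b * (z + of_real v) ^ m"
  unfolding poly_appell_poly binomial_ring sum_distrib_left sum.distrib[symmetric]
  by (intro sum.cong refl) (simp add: algebra_simps)

text \<open>A sequence that is geometric up to \<open>m\<close> has \<open>appell_poly m e = e\<^sub>0 (X + q)\<^sup>m\<close>, so the polynomial one
  level up is \<open>e\<^sub>0 (X + q)\<^bsup>m+1\<^esup> + d\<close>, which has nonreal roots unless \<open>d = 0\<close>.\<close>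

lemma geometric_upto_Suc:
  assumes rr: "real_rooted (Suc m) e" and geo: "geometric_upto m q e" and m: "m \<ge> 2"
  shows "geometric_upto (Suc m) q e"
proof -
  define d where "d = e (Suc m) - e 0 * q ^ Suc m"
  have e0: "e 0 \<noteq> 0"
    using geo unfolding geometric_upto_def by blast
  have e: "e j = e 0 * q ^ j" if "j \<le> m" for j
    using geo that unfolding geometric_upto_def by blast
  have p: "poly (appell_poly (Suc m) e) z = of_real (e 0) * (z + of_real q) ^ Suc m + of_real d" for z
  proof -
    have "poly (appell_poly (Suc m) e) z = of_real (e (Suc m))
        + (\<Sum>i\<le>m. of_real (real (Suc m choose Suc i) * e (m - i)) * z ^ Suc i)"
      by (simp add: poly_appell_poly sum.atMost_Suc_shift del: sum.atMost_Suc binomial_Suc_Suc)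
    also have "(\<Sum>i\<le>m. of_real (real (Suc m choose Suc i) * e (m - i)) * z ^ Suc i)
        = (\<Sum>i\<le>m. of_real (real (Suc m choose Suc i) * (e 0 * q ^ (m - i))) * z ^ Suc i)"
      by (intro sum.cong refl) (simp only: e[OF diff_le_self])
    \<comment> \<open>The dummy term \<open>0 * 0 ^ j\<close> fits the two-term formula.\<close>
    also have "of_real (e (Suc m)) + \<dots>
        = poly (appell_poly (Suc m) (\<lambda>j. e 0 * q ^ j + 0 * 0 ^ j)) z + of_real d"
      by (simp add: poly_appell_poly sum.atMost_Suc_shift d_def del: sum.atMost_Suc binomial_Suc_Suc)
    finally show ?thesis
      unfolding poly_appell_poly_geometric by simp
  qed
  have "d = 0"
  proof (rule ccontr)
    assume "d \<noteq> 0"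
    with e0 have "- d / e 0 \<noteq> 0" by simp
    then obtain w where w: "Im w \<noteq> 0" "w ^ Suc m = of_real (- d / e 0)"
      by (rule exists_nonreal_nth_root[of _ "Suc m"]) (use m in simp)
    have "poly (appell_poly (Suc m) e) (w - of_real q) = 0"
      unfolding p using w(2) e0 by (simp del: power_Suc)
    moreover have "appell_poly (Suc m) e \<noteq> 0"
      using e0 by (auto simp: appell_poly_eq_0_iff)
    ultimately show False
      using rr w(1) by (auto simp: real_rooted_def)
  qed
  then show ?thesis
    using e0 e unfolding geometric_upto_def d_def by (metis le_Suc_eq eq_iff_diff_eq_0)
qed

text \<open>Here the polynomial one level up is \<open>c (X + q)\<^bsup>m+1\<^esup> + d (X - a)\<^bsup>m+1\<^esup>\<close>, and \<open>d = 0\<close> follows by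
  taking a nonreal \<open>(m+1)\<close>-st root of \<open>-d / c\<close> for the ratio of the two linear forms.\<close>

lemma geometric_upto_polar:
  assumes rr: "real_rooted (Suc m) e" and geo: "geometric_upto m q (polar a e)"
    and m: "m \<ge> 2" and q: "q \<noteq> - a"
  shows "geometric_upto (Suc m) q e"
proof -
  \<comment> \<open>The recurrence \<open>e (Suc j) + a * e j = polar a e 0 * q ^ j\<close> has the
    particular solution c q^j, available because q + a is nonzero, and the homogeneous solutions d
    (-a)^j.\<close>
  define c where "c = polar a e 0 / (q + a)"
  define d where "d = e 0 - c"
  have p0: "polar a e 0 \<noteq> 0"
    using geo unfolding geometric_upto_def by blast
  have qa: "q + a \<noteq> 0"
    using q by simp
  with p0 have c: "c \<noteq> 0"
    by (simp add: c_def)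
  have e: "e j = c * q ^ j + d * (- a) ^ j" if "j \<le> Suc m" for j
    using that
  proof (induction j)
    case (Suc j)
    have "polar a e j = polar a e 0 * q ^ j"
      using geo Suc.prems unfolding geometric_upto_def by (blast dest: Suc_le_mono[THEN iffD1])
    then have "e (Suc j) = polar a e 0 * q ^ j - a * e j"
      by (simp add: polar_def[of a e j])
    also have "polar a e 0 = c * (q + a)"
      using qa by (simp add: c_def)
    finally show ?case
      using Suc by (simp add: algebra_simps)
  qed (simp add: d_def)
  have p: "poly (appell_poly (Suc m) e) z
      = of_real c * (z + of_real q) ^ Suc m + of_real d * (z - of_real a) ^ Suc m" for z
    using appell_poly_cong[of "Suc m" e, OF e] poly_appell_poly_geometric[of "Suc m" c q d "- a" z]
    by simp
  have "d = 0"
  proof (rule ccontr)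
    assume "d \<noteq> 0"
    with c have "- d / c \<noteq> 0" by simp
    then obtain w where w: "Im w \<noteq> 0" "w ^ Suc m = of_real (- d / c)"
      by (rule exists_nonreal_nth_root[of _ "Suc m"]) (use m in simp)
    \<comment> \<open>The solution of (z + q) / (z - a) = w; it is nonreal because w is and q + a is
      real and nonzero.\<close>
    define z where "z = of_real a + of_real (q + a) / (w - 1)"
    have w1: "w - 1 \<noteq> 0"
      using w(1) by auto
    have zq: "z + of_real q = w * (z - of_real a)"
      using w1 by (simp add: z_def field_simps)
    have "poly (appell_poly (Suc m) e) z = 0"
      unfolding p zq power_mult_distrib w(2) using c by simp
    moreover have "appell_poly (Suc m) e \<noteq> 0"
    proof
      assume "appell_poly (Suc m) e = 0"
      then have "polar a e 0 = 0"
        by (simp add: appell_poly_eq_0_iff polar_def)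
      with p0 show False by simp
    qed
    moreover have "Im z \<noteq> 0"
      using w qa w1 by (auto simp: z_def Im_divide complex_eq_iff sum_power2_eq_zero_iff)
    ultimately show False
      using rr by (auto simp: real_rooted_def)
  qed
  then show ?thesis
    using e c by (simp add: geometric_upto_def)
qed

section \<open>Transfer between levels and shifts\<close>

lemma real_rooted_le:
  assumes "real_rooted n e" "m \<le> n"
  shows "real_rooted m e"
  using assms(2,1) by (induction rule: inc_induct) (auto intro: real_rooted_Suc)

lemma real_rooted_shift:
  assumes "real_rooted (m + i) e"
  shows "real_rooted m (\<lambda>j. e (j + i))"
  using assms
proof (induction i arbitrary: m)
  case (Suc i)
  have "real_rooted m (polar 0 (\<lambda>j. e (j + i)))"
    using Suc by (intro real_rooted_polar) simp
  then show ?case by (simp add: polar_def[abs_def])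
qed simp

lemma geometric_upto_extend:
  assumes "real_rooted n e" "geometric_upto m q e" "2 \<le> m" "m \<le> n"
  shows "geometric_upto n q e"
  using assms(4,1-3)
proof (induction rule: dec_induct)
  case (step n)
  then show ?case
    by (intro geometric_upto_Suc) (auto intro: real_rooted_Suc)
qed

text \<open>Each unshift undoes a polar derivative with pole 0; \<open>q \<noteq> 0\<close> keeps
  the root -q away from that pole.\<close>

lemma geometric_upto_unshift:
  assumes "real_rooted (m + i) e" "geometric_upto m q (\<lambda>j. e (j + i))" "2 \<le> m" "q \<noteq> 0"
  shows "geometric_upto (m + i) q e"
  using assms
proof (induction i arbitrary: m)
  case (Suc i)
  have "geometric_upto (Suc m) q (\<lambda>j. e (j + i))"
    using Suc.prems
    by (intro geometric_upto_polar[where a = 0] real_rooted_shift) (auto simp: polar_def[abs_def])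
  then show ?case
    using Suc.IH[of "Suc m"] Suc.prems by simp
qed simp

section \<open>Newton's inequality\<close>

lemma real_rooted_2_imp_newton:
  assumes "real_rooted 2 e"
  shows "e 0 * e 2 \<le> (e 1)\<^sup>2"
proof (rule ccontr)
  assume *: "\<not> e 0 * e 2 \<le> (e 1)\<^sup>2"
  define D where "D = e 0 * e 2 - (e 1)\<^sup>2"
  have D: "D > 0" and e0: "e 0 \<noteq> 0"
    using * by (auto simp: D_def)
  \<comment> \<open>The quadratic formula, for discriminant -4D.\<close>
  define z where "z = Complex (- e 1 / e 0) (sqrt D / e 0)"
  have p: "poly (appell_poly 2 e) z = of_real (e 2) + of_real (2 * e 1) * z + of_real (e 0) * z\<^sup>2"
    by (simp add: poly_appell_poly eval_nat_numeral)
  have "sqrt D * sqrt D = e 0 * e 2 - e 1 * e 1"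
    using D by (simp add: D_def power2_eq_square)
  then have "poly (appell_poly 2 e) z = 0"
    unfolding p using e0
    by (simp add: z_def complex_eq_iff diff_divide_distrib[symmetric] power2_eq_square divide_simps)
  moreover have "appell_poly 2 e \<noteq> 0"
    using e0 by (auto simp: appell_poly_eq_0_iff)
  moreover have "Im z \<noteq> 0"
    using D e0 by (simp add: z_def)
  ultimately show False
    using assms by (auto simp: real_rooted_def)
qed

lemma real_rooted_imp_newton:
  assumes "real_rooted n e" "i + 2 \<le> n"
  shows "e i * e (i + 2) \<le> (e (i + 1))\<^sup>2"
proof -
  have "real_rooted 2 (\<lambda>j. e (j + i))"
    using assms by (intro real_rooted_shift real_rooted_le[OF assms(1)]) simp
  from real_rooted_2_imp_newton[OF this] show ?thesis
    by (simp add: add.commute)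
qed

text \<open>Newton's inequality and the sign condition force \<open>e (i + 2) = 0\<close> as well.
  From index i on, the sequence thus begins geometrically with ratio 0, and this extends to all
  levels.\<close>

lemma real_rooted_zeros:
  assumes rr: "real_rooted n e" and i: "i + 2 \<le> n"
    and e: "e i \<noteq> 0" "e (i + 1) = 0" "e i * e (i + 2) \<ge> 0" and j: "i < j" "j \<le> n"
  shows "e j = 0"
proof -
  let ?g = "\<lambda>j. e (j + i)"
  have rg: "real_rooted (n - i) ?g"
    using rr i by (intro real_rooted_shift) simp
  have "e (i + 2) = 0"
    using real_rooted_imp_newton[OF rr i] e by auto
  with e have "geometric_upto 2 0 ?g"
    by (auto simp: geometric_upto_def le_Suc_eq eval_nat_numeral)
  then have "geometric_upto (n - i) 0 ?g"
    using geometric_upto_extend[OF rg] i by simp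
  then have "?g (j - i) = ?g 0 * 0 ^ (j - i)"
    using j unfolding geometric_upto_def by (meson diff_le_mono)
  then show ?thesis
    using j by simp
qed

text \<open>Equality is a double root -q. Undoing pole b, pole a, the shift by i and finally
  derivatives lifts it through the levels 2, 3, 4, i + 4, n; \<open>ne\<close> and \<open>nz\<close>
  keep -q away from the poles b, a and 0.\<close>

lemma real_rooted_newton_eq:
  fixes a b :: real
  defines "s \<equiv> \<lambda>e. polar b (polar a e)"
  assumes rr: "real_rooted n e" and i: "i + 4 \<le> n"
    and eq: "s e i * s e (i + 2) = (s e (i + 1))\<^sup>2" and nz: "s e (i + 1) \<noteq> 0"
    and ne: "s e (i + 1) / s e i \<noteq> - a" "s e (i + 1) / s e i \<noteq> - b"
  shows "geometric_upto n (s e (i + 1) / s e i) e"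
proof -
  let ?q = "s e (i + 1) / s e i" and ?g = "\<lambda>j. e (j + i)"
  have s0: "s e i \<noteq> 0" using eq nz by auto
  have g: "real_rooted 4 ?g"
    by (intro real_rooted_shift real_rooted_le[OF rr]) (use i in simp)
  have sg: "s ?g j = s e (j + i)" for j
    by (simp add: s_def polar_def)
  have "geometric_upto 2 ?q (s ?g)"
    using s0 eq
    by (auto simp: geometric_upto_def sg le_Suc_eq eval_nat_numeral field_simps)
  then have "geometric_upto 3 ?q (polar a ?g)"
    using geometric_upto_polar[of 2 "polar a ?g" ?q b] real_rooted_polar[of 3 ?g a] g ne
    by (simp add: s_def eval_nat_numeral)
  then have "geometric_upto 4 ?q ?g"
    using geometric_upto_polar[of 3 ?g ?q a] g ne by (simp add: eval_nat_numeral)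
  then have "geometric_upto (4 + i) ?q e"
    using s0 nz i by (intro geometric_upto_unshift real_rooted_le[OF rr]) auto
  then show ?thesis
    by (rule geometric_upto_extend[OF rr]) (use i in auto)
qed

section \<open>Elementary symmetric means\<close>

lemma prod_add_const_eq_sum_elem_sym:
  fixes x :: "real ^ 'n" and z :: complex
  shows "(\<Prod>i\<in>UNIV. of_real (x $ i) + z)
    = (\<Sum>k\<le>CARD('n). of_real (elem_sym k x) * z ^ (CARD('n) - k))"
proof -
  have "(\<Prod>i\<in>UNIV. of_real (x $ i) + z)
      = (\<Sum>X\<in>Pow (UNIV :: 'n set). of_real (\<Prod>i\<in>X. x $ i) * z ^ (CARD('n) - card X))"
    by (subst prod_add) (auto simp: card_Diff_subset)
  also have "\<dots> = (\<Sum>k\<le>CARD('n). \<Sum>X\<in>{X \<in> Pow (UNIV :: 'n set). card X = k}.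
      of_real (\<Prod>i\<in>X. x $ i) * z ^ (CARD('n) - card X))"
    by (rule sum.group[symmetric]) (auto intro: card_mono)
  also have "\<dots> = (\<Sum>k\<le>CARD('n). of_real (elem_sym k x) * z ^ (CARD('n) - k))"
    by (intro sum.cong) (auto simp: elem_sym_def sum_distrib_right intro!: sum.cong)
  finally show ?thesis .
qed

lemma poly_appell_poly_elem_mean:
  fixes x :: "real ^ 'n"
  shows "poly (appell_poly (CARD('n)) (\<lambda>j. elem_mean (int j) x)) z = (\<Prod>i\<in>UNIV. of_real (x $ i) + z)"
proof -
  have "(\<Prod>i\<in>UNIV. of_real (x $ i) + z)
      = (\<Sum>i\<le>CARD('n). of_real (elem_sym (CARD('n) - i) x) * z ^ i)"
    unfolding prod_add_const_eq_sum_elem_sym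
    by (rule sum.reindex_bij_witness[of _ "\<lambda>i. CARD('n) - i" "\<lambda>i. CARD('n) - i"]) auto
  also have "\<dots> = poly (appell_poly (CARD('n)) (\<lambda>j. elem_mean (int j) x)) z"
    unfolding poly_appell_poly
  proof (intro sum.cong refl)
    fix i assume "i \<in> {..CARD('n)}"
    then have "nat (int (CARD('n) - i)) = CARD('n) - i"
        and "real (CARD('n) choose (CARD('n) - i)) = real (CARD('n) choose i)"
        and "real (CARD('n) choose i) \<noteq> 0"
      by (simp_all add: binomial_symmetric[symmetric])
    then show "of_real (elem_sym (CARD('n) - i) x) * z ^ i
        = of_real (real (CARD('n) choose i) * elem_mean (int (CARD('n) - i)) x) * z ^ i"
      unfolding elem_mean_def by (simp del: of_nat_diff of_real_of_nat_eq)
  qed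
  finally show ?thesis ..
qed

lemma real_rooted_elem_mean:
  fixes x :: "real ^ 'n"
  shows "real_rooted (CARD('n)) (\<lambda>j. elem_mean (int j) x)"
proof -
  have "of_real (x $ i) + z \<noteq> 0" if "Im z \<noteq> 0" for i z
    using that by (auto simp: complex_eq_iff)
  then show ?thesis
    by (simp add: real_rooted_def poly_appell_poly_elem_mean)
qed

text \<open>At -x_i the polynomial (X + q)^n takes the value (q - x_i)^n, while its product form has
  a zero factor.\<close>

lemma geometric_upto_elem_mean:
  fixes x :: "real ^ 'n"
  assumes "geometric_upto (CARD('n)) q (\<lambda>j. elem_mean (int j) x)"
  shows "x $ i = q"
proof -
  have "appell_poly (CARD('n)) (\<lambda>j. elem_mean (int j) x) = appell_poly (CARD('n)) (\<lambda>j. 1 * q ^ j + 0 * 0 ^ j)"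
    using assms unfolding geometric_upto_def
    by (intro appell_poly_cong) (metis add_0_right elem_mean_0 mult_zero_left of_nat_0)
  from arg_cong[OF this, of "\<lambda>p. poly p (- of_real (x $ i))"]
  have "(\<Prod>j\<in>UNIV. of_real (x $ j) - complex_of_real (x $ i)) = (of_real q - of_real (x $ i)) ^ CARD('n)"
    unfolding poly_appell_poly_geometric poly_appell_poly_elem_mean by simp
  moreover have "(\<Prod>j\<in>UNIV. of_real (x $ j) - complex_of_real (x $ i)) = 0"
    by auto
  ultimately show ?thesis by simp
qed

section \<open>The means S and the chain of roots\<close>

lemma lin_mean_eq_polar:
  "lin_mean a b (int j + 2) x = polar b (polar a (\<lambda>j. elem_mean (int j) x)) j"
  by (simp add: lin_mean_def polar_def algebra_simps)

text \<open>Maclaurin's derivation from Newton's inequalities: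
  \<open>s (m + 1) ^ m \<le> s m ^ (m + 1)\<close> by induction, cancelling a power of
  \<open>s (m + 1)\<close> in each step; \<open>zero\<close> takes over where that term
  vanishes.\<close>

lemma root_chain:
  fixes s :: "nat \<Rightarrow> real"
  assumes s0: "s 0 = 1" and nonneg: "\<And>j. j \<le> k \<Longrightarrow> s j \<ge> 0"
    and newton: "\<And>j. j + 2 \<le> k \<Longrightarrow> s j * s (j + 2) \<le> (s (j + 1))\<^sup>2"
    and zero: "\<And>j. 1 \<le> j \<Longrightarrow> j < k \<Longrightarrow> s j = 0 \<Longrightarrow> s (j + 1) = 0"
    and m: "1 \<le> m" "m < k"
  shows "root (m + 1) (s (m + 1)) \<le> root m (s m)"
proof -
  have pow: "s (m + 1) ^ m \<le> s m ^ (m + 1)"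
    using \<open>m < k\<close>
  proof (induction m)
    case (Suc m)
    let ?t = "s (m + 1)"
    have nn: "s m \<ge> 0" "?t \<ge> 0" "s (m + 2) \<ge> 0"
      using nonneg Suc.prems by auto
    show ?case
    proof (cases "?t = 0")
      case True
      then show ?thesis using zero[of "m + 1"] Suc.prems by simp
    next
      case False
      have "?t ^ m * s (m + 2) ^ (m + 1) \<le> s m ^ (m + 1) * s (m + 2) ^ (m + 1)"
        using Suc nn by (intro mult_right_mono) auto
      also have "\<dots> = (s m * s (m + 2)) ^ (m + 1)"
        by (simp only: power_mult_distrib)
      also have "\<dots> \<le> (?t\<^sup>2) ^ (m + 1)"
        using newton[of m] Suc.prems nn by (intro power_mono) auto
      also have "\<dots> = ?t ^ m * ?t ^ (m + 2)"
      proof -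
        have "2 * (m + 1) = m + (m + 2)" by simp
        then show ?thesis by (simp only: power_mult[symmetric] power_add[symmetric])
      qed
      finally show ?thesis
        using False nn by (simp add: mult_le_cancel_left_pos)
    qed
  qed (simp add: s0)
  have nn: "s m \<ge> 0" "s (m + 1) \<ge> 0"
    using nonneg m by auto
  have "root (m + 1) (s (m + 1)) ^ (m * (m + 1)) = s (m + 1) ^ m"
    using nn by (simp only: mult.commute[of m] power_mult) (simp add: real_root_pow_pos2 del: power_Suc)
  moreover have "root m (s m) ^ (m * (m + 1)) = s m ^ (m + 1)"
    using nn m by (simp only: power_mult) (simp add: real_root_pow_pos2 del: power_Suc)
  ultimately have "root (m + 1) (s (m + 1)) ^ (m * (m + 1)) \<le> root m (s m) ^ (m * (m + 1))"
    using pow by simp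
  then show ?thesis
    using m nn by (subst (asm) power_mono_iff) auto
qed

lemma real_rooted_lin_mean:
  fixes x :: "real ^ 'n"
  assumes "2 \<le> CARD('n)"
  shows "real_rooted (CARD('n) - 2) (\<lambda>j. lin_mean a b (int j + 2) x)"
  unfolding lin_mean_eq_polar
  using real_rooted_elem_mean[of x] assms
  by (intro real_rooted_polar) (simp add: Suc_diff_le numeral_2_eq_2 Suc_diff_Suc)

text \<open>Newton's inequality at index 2, which is not covered by the polar derivative argument
  because \<open>E\<^sub>-\<^sub>1 = 0\<close> enters \<open>S\<^sub>1\<close>; it needs the sign conditions.\<close>

lemma newton_2_of_elem_means:
  fixes a b e1 e2 e3 :: real
  assumes nonneg: "0 \<le> a" "0 \<le> b" "0 \<le> e1" "0 \<le> e2"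
    and newton: "e2 \<le> e1\<^sup>2" "e1 * e3 \<le> e2\<^sup>2" and zero: "e1 = 0 \<Longrightarrow> e3 = 0"
  shows "(e1 + (a + b)) * (e3 + (a + b) * e2 + a * b * e1) \<le> (e2 + (a + b) * e1 + a * b)\<^sup>2"
proof -
  \<comment> \<open>Chain e1 e3 \<le> e2^2 \<le> e1^2 e2 and cancel e1.\<close>
  have e3: "e3 \<le> e1 * e2"
  proof (cases "e1 = 0")
    case False
    have "e2 * e2 \<le> e1\<^sup>2 * e2"
      using nonneg newton by (intro mult_right_mono) auto
    with newton have "e1 * e3 \<le> e1 * (e1 * e2)"
      by (simp add: power2_eq_square mult.assoc)
    with False nonneg show ?thesis by simp
  qed (simp add: zero)
  \<comment> \<open>Writing (a + b)^2 = (a - b)^2 + 4ab turns the coefficient 2 e2 - e1^2 of ab,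
    possibly negative, into 3 e1^2 - 2 e2.\<close>
  have "0 \<le> e2\<^sup>2 - e1 * e3" "0 \<le> (a + b) * (e1 * e2 - e3)"
    "0 \<le> (a - b)\<^sup>2 * (e1\<^sup>2 - e2)" "0 \<le> (a * b)\<^sup>2" "0 \<le> (a + b) * (a * b) * e1"
    "0 \<le> a * b * (3 * e1\<^sup>2 - 2 * e2)"
    using e3 nonneg newton by auto
  moreover have "(e2 + (a + b) * e1 + a * b)\<^sup>2 - (e1 + (a + b)) * (e3 + (a + b) * e2 + a * b * e1)
    = (e2\<^sup>2 - e1 * e3) + (a + b) * (e1 * e2 - e3) + (a - b)\<^sup>2 * (e1\<^sup>2 - e2)
      + (a * b)\<^sup>2 + (a + b) * (a * b) * e1 + a * b * (3 * e1\<^sup>2 - 2 * e2)"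
    by (simp add: power2_eq_square algebra_simps)
  ultimately show ?thesis by linarith
qed

text \<open>Newton's inequality alone does not exclude a zero followed by a positive term once the
  preceding term vanishes too; this uses real-rootedness.\<close>

lemma lin_mean_zero_imp_next_zero:
  fixes a b :: real and x :: "real ^ 'n"
  defines "s \<equiv> \<lambda>j. lin_mean a b (int j) x"
  assumes ab: "0 \<le> a" "0 \<le> b" and e1: "0 \<le> elem_mean 1 x" and e2: "0 \<le> elem_mean 2 x"
    and k: "k \<le> CARD('n)" and nonneg: "\<And>j. j \<le> k \<Longrightarrow> 0 \<le> s j"
    and j: "1 \<le> j" "j < k" "s j = 0"
  shows "s (j + 1) = 0"
proof -
  let ?n = "CARD('n)"
  define e where "e j = elem_mean (int j) x" for j
  have rr: "real_rooted ?n e"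
    unfolding e_def by (rule real_rooted_elem_mean)
  have rs: "real_rooted (?n - 2) (\<lambda>j. s (j + 2))"
    using real_rooted_lin_mean[of a b x] j k by (simp add: s_def add.commute)
  have e0: "e 0 = 1" by (simp add: e_def elem_mean_0)
  have e12: "0 \<le> e 1" "0 \<le> e 2" using e1 e2 by (simp_all add: e_def)
  have s1: "s 1 = e 1 + (a + b)"
    by (simp add: s_def e_def lin_mean_def elem_mean_0 elem_mean_def[of "- 1"])
  have s: "s (j + 2) = e (j + 2) + (a + b) * e (j + 1) + a * b * e j" for j
    by (simp add: s_def e_def lin_mean_def algebra_simps)
  show ?thesis
  proof (cases "e 1 = 0")
    case True
    have z: "e i = 0" if "0 < i" "i \<le> ?n" for i
      by (rule real_rooted_zeros[OF rr, of 0]) (use j k True e0 e12 that in \<open>auto simp: numeral_2_eq_2\<close>)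
    show ?thesis
    proof (cases "j = 1")
      case True
      then have "a + b = 0" using s1 z[of 1] j k by simp
      then have "a = 0" "b = 0" using ab by linarith+
      with True show ?thesis using s[of 0] z[of 2] z[of 1] j k by (simp add: eval_nat_numeral)
    next
      case False
      then obtain i where "j = i + 2" using j by (metis add.commute le_Suc_ex numeral_2_eq_2 One_nat_def Suc_leI le_neq_implies_less)
      then show ?thesis using s[of "i + 1"] z j k by (simp add: eval_nat_numeral)
    qed
  next
    case False
    with e12 have e1: "e 1 > 0" by simp
    with s1 ab have s1: "s 1 > 0" by simp
    \<comment> \<open>The first zero has a nonzero predecessor, as \<open>real_rooted_zeros\<close>
      requires.\<close>
    define i where "i = (LEAST i. 1 \<le> i \<and> s i = 0)"
    have i: "1 \<le> i" "s i = 0" "i \<le> j"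
      using LeastI[of "\<lambda>i. 1 \<le> i \<and> s i = 0" j] Least_le[of "\<lambda>i. 1 \<le> i \<and> s i = 0" j] j
      by (auto simp: i_def)
    have i1: "i \<noteq> 1" using i s1 by auto
    have prev: "s (i - 1) \<noteq> 0"
      using not_less_Least[of "i - 1" "\<lambda>i. 1 \<le> i \<and> s i = 0"] i i1
      unfolding i_def[symmetric] by auto
    have pos: "0 \<le> s (i - 1)" "0 \<le> s (i + 1)" using nonneg i j by auto
    show ?thesis
    \<comment> \<open>For i = 2 the predecessor S_1 lies outside the real-rooted range, but the
      signs force a = b = 0. Then S coincides with E, and the zeros propagate along E.\<close>
    proof (cases "i = 2")
      case True
      have "0 \<le> (a + b) * e 1" "0 \<le> a * b" using ab e12 by auto
      moreover have "e 2 + (a + b) * e 1 + a * b = 0"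
        using s[of 0] i True e0 by (simp add: numeral_2_eq_2)
      ultimately have "e 2 = 0" and "(a + b) * e 1 = 0"
        using e12 by linarith+
      with e1 have "a + b = 0" by simp
      with ab have "a = 0" "b = 0" by linarith+
      then have se: "s m = e m" for m
        by (simp add: s_def e_def lin_mean_def)
      have "e (j + 1) = 0"
        by (rule real_rooted_zeros[OF rr, of 1])
          (use \<open>e 2 = 0\<close> e1 i j k True pos in \<open>auto simp: se eval_nat_numeral\<close>)
      then show ?thesis by (simp add: se)
    next
      case False
      \<comment> \<open>In the sequence shifted by 2, index l belongs to S_(i-1).\<close>
      define l where "l = i - 3"
      have l: "i = l + 3" using False i i1 by (simp add: l_def)
      have "s (j - 1 + 2) = 0"
        by (rule real_rooted_zeros[OF rs, of l])
          (use i j k l prev pos in \<open>auto simp: eval_nat_numeral\<close>)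
      then show ?thesis using j by simp
    qed
  qed
qed

text \<open>Supplies the hypotheses of \<open>root_chain\<close>: Newton's inequality centred at S_1
  and S_2 is checked by hand, from S_3 on it follows from real-rootedness.\<close>

lemma lin_mean_root_chain:
  fixes a b :: real and x :: "real ^ 'n"
  defines "s \<equiv> \<lambda>j. lin_mean a b (int j) x"
  assumes ab: "0 \<le> a" "0 \<le> b" and e1: "0 \<le> elem_mean 1 x" and e2: "0 \<le> elem_mean 2 x"
    and k: "k \<le> CARD('n)" and nonneg: "\<And>j. 3 \<le> j \<Longrightarrow> j \<le> k \<Longrightarrow> 0 \<le> s j"
    and m: "1 \<le> m" "m < k"
  shows "root (m + 1) (s (m + 1)) \<le> root m (s m)"
proof -
  let ?n = "CARD('n)"
  define e where "e j = elem_mean (int j) x" for j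
  have rr: "real_rooted ?n e"
    unfolding e_def by (rule real_rooted_elem_mean)
  have rs: "real_rooted (?n - 2) (\<lambda>j. s (j + 2))"
    using real_rooted_lin_mean[of a b x] m k by (simp add: s_def add.commute)
  have e0: "e 0 = 1" by (simp add: e_def elem_mean_0)
  have e12: "0 \<le> e 1" "0 \<le> e 2" using e1 e2 by (simp_all add: e_def)
  \<comment> \<open>The default values E_(-1) = E_(-2) = 0 enter here.\<close>
  have s0: "s 0 = 1"
    by (simp add: s_def e_def lin_mean_def elem_mean_0 elem_mean_def[of "- 1"] elem_mean_def[of "- 2"])
  have s1: "s 1 = e 1 + (a + b)"
    by (simp add: s_def e_def lin_mean_def elem_mean_0 elem_mean_def[of "- 1"])
  have s2: "s 2 = e 2 + (a + b) * e 1 + a * b"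
    by (simp add: s_def e_def lin_mean_def elem_mean_0)
  have s3: "s 3 = e 3 + (a + b) * e 2 + a * b * e 1"
    by (simp add: s_def e_def lin_mean_def)
  have nonneg': "0 \<le> s j" if "j \<le> k" for j
  proof -
    consider "j = 0" | "j = 1" | "j = 2" | "j \<ge> 3" by linarith
    then show ?thesis
      by cases (use s0 s1 s2 e12 ab nonneg that in auto)
  qed
  have newton1: "e 2 \<le> (e 1)\<^sup>2"
    using real_rooted_imp_newton[OF rr, of 0] e0 m k by (simp add: eval_nat_numeral)
  have newton: "s j * s (j + 2) \<le> (s (j + 1))\<^sup>2" if "j + 2 \<le> k" for j
  proof -
    consider "j = 0" | "j = 1" | i where "j = i + 2"
      by (metis One_nat_def add.commute add_2_eq_Suc' not0_implies_Suc)
    then show ?thesis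
    proof cases
      case 1
      have "0 \<le> (a + b) * e 1" "0 \<le> a\<^sup>2 + b\<^sup>2 + a * b" using ab e12 by auto
      moreover have "(s 1)\<^sup>2 - s 2 = ((e 1)\<^sup>2 - e 2) + (a + b) * e 1 + (a\<^sup>2 + b\<^sup>2 + a * b)"
        unfolding s1 s2 by (simp add: power2_eq_square algebra_simps)
      ultimately have "s 2 \<le> (s 1)\<^sup>2" using newton1 by linarith
      with 1 s0 show ?thesis by (simp add: eval_nat_numeral)
    next
      case 2
      have "e 1 * e 3 \<le> (e 2)\<^sup>2"
        using real_rooted_imp_newton[OF rr, of 1] that 2 k by (simp add: eval_nat_numeral)
      moreover have "e 3 = 0" if "e 1 = 0"
        by (rule real_rooted_zeros[OF rr, of 0]) (use \<open>j + 2 \<le> k\<close> 2 k that e0 e12 in \<open>auto simp: numeral_2_eq_2\<close>)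
      ultimately have "s 1 * s 3 \<le> (s 2)\<^sup>2"
        unfolding s1 s2 s3 using ab e12 newton1 by (intro newton_2_of_elem_means)
      with 2 show ?thesis by (simp add: eval_nat_numeral)
    next
      case 3
      then show ?thesis
        using real_rooted_imp_newton[OF rs, of i] that k by (simp add: eval_nat_numeral)
    qed
  qed
  have zero: "s (j + 1) = 0" if "1 \<le> j" "j < k" "s j = 0" for j
    unfolding s_def by (rule lin_mean_zero_imp_next_zero[OF ab e1 e2 k]) (use nonneg' that s_def in auto)
  show ?thesis
    by (rule root_chain[of s k]) (use s0 nonneg' newton zero m in auto)
qed

text \<open>Nonzero denominators are explicit because division by 0 yields 0. The ratio is compared
  with each pole separately, since lifting the double root may fail as soon as it meets one of
  them.\<close>

theorem theorem1:
  fixes \<alpha> \<beta> :: real and x :: "real ^ 'n"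
  defines "E \<equiv> \<lambda>k. elem_mean k x"
    and "S \<equiv> \<lambda>k. lin_mean \<alpha> \<beta> k x"
  shows "(\<forall>k \<in> {3 .. int CARD('n) - 1}. (S k)\<^sup>2 \<ge> S (k - 1) * S (k + 1))
    \<and> (\<forall>k \<in> {3 .. int CARD('n) - 1}.
         \<not> ((\<forall>i j. x $ i = x $ j)
            \<or> ((S k)\<^sup>2 = 0 \<and> S (k - 1) * S (k + 1) = 0)
            \<or> (S (k - 1) \<noteq> 0 \<and> S k \<noteq> 0
               \<and> S k / S (k - 1) = S (k + 1) / S k
               \<and> (S (k + 1) / S k = - \<alpha> \<or> S (k + 1) / S k = - \<beta>)))
         \<longrightarrow> (S k)\<^sup>2 > S (k - 1) * S (k + 1))
    \<and> (\<forall>k \<in> {2 .. CARD('n)}.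
         \<alpha> \<ge> 0 \<and> \<beta> \<ge> 0 \<and> E 1 \<ge> 0 \<and> E 2 \<ge> 0 \<and> (\<forall>m \<in> {3 .. k}. S (int m) \<ge> 0)
         \<longrightarrow> (\<forall>m \<in> {1 ..< k}. root m (S (int m)) \<ge> root (m + 1) (S (int (m + 1)))))"
proof -
  define e where "e j = elem_mean (int j) x" for j
  define s where "s = polar \<beta> (polar \<alpha> e)"
  have index: "\<exists>i. i + 4 \<le> CARD('n) \<and> S (k - 1) = s i \<and> S k = s (i + 1) \<and> S (k + 1) = s (i + 2)"
    if "k \<in> {3 .. int CARD('n) - 1}" for k
  proof -
    \<comment> \<open>The offset 3 makes S_(k-1) = S_(i+2) the term \<open>s i\<close>, so only
      means of nonnegative index enter.\<close>
    define i where "i = nat (k - 3)"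
    have k: "k = int i + 3" and "i + 4 \<le> CARD('n)"
      using that by (auto simp: i_def)
    moreover have "S (int j + 2) = s j" for j
      unfolding S_def s_def e_def by (rule lin_mean_eq_polar)
    from this[of i] this[of "i + 1"] this[of "i + 2"]
    have "S (k - 1) = s i" "S k = s (i + 1)" "S (k + 1) = s (i + 2)"
      by (simp_all add: k algebra_simps)
    ultimately show ?thesis by blast
  qed
  have rr: "real_rooted (CARD('n)) e"
    unfolding e_def by (rule real_rooted_elem_mean)
  have newton: "s i * s (i + 2) \<le> (s (i + 1))\<^sup>2" if "i + 4 \<le> CARD('n)" for i
  proof -
    have "real_rooted (i + 4) e"
      using rr that by (rule real_rooted_le)
    then have "real_rooted (i + 2) s"
      unfolding s_def by (intro real_rooted_polar) (simp add: eval_nat_numeral)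
    then show ?thesis
      by (rule real_rooted_imp_newton) simp
  qed
  have strict: "s i * s (i + 2) < (s (i + 1))\<^sup>2"
    if i: "i + 4 \<le> CARD('n)" and ne: "\<not> (\<forall>i j. x $ i = x $ j)"
      and nz: "\<not> ((s (i + 1))\<^sup>2 = 0 \<and> s i * s (i + 2) = 0)"
      and ratio: "\<not> (s i \<noteq> 0 \<and> s (i + 1) \<noteq> 0 \<and> s (i + 1) / s i = s (i + 2) / s (i + 1)
        \<and> (s (i + 2) / s (i + 1) = - \<alpha> \<or> s (i + 2) / s (i + 1) = - \<beta>))" for i
  proof (rule ccontr)
    assume "\<not> s i * s (i + 2) < (s (i + 1))\<^sup>2"
    with newton[OF i] have eq: "s i * s (i + 2) = (s (i + 1))\<^sup>2" by simp
    with nz have s1: "s (i + 1) \<noteq> 0" by auto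
    with eq have s0: "s i \<noteq> 0" by auto
    have r: "s (i + 1) / s i = s (i + 2) / s (i + 1)"
      using eq s0 s1 by (simp add: field_simps power2_eq_square)
    \<comment> \<open>The negated ratio clause excludes both poles, so equality lifts to the full
      polynomial.\<close>
    have "geometric_upto (CARD('n)) (s (i + 1) / s i) e"
      using real_rooted_newton_eq[OF rr i, of \<beta> \<alpha>] eq s0 s1 r ratio unfolding s_def by metis
    then have "x $ j = s (i + 1) / s i" for j
      unfolding e_def by (rule geometric_upto_elem_mean)
    with ne show False by simp
  qed
  show ?thesis
  proof (intro conjI ballI impI)
    fix k assume "k \<in> {3 .. int CARD('n) - 1}"
    then show "(S k)\<^sup>2 \<ge> S (k - 1) * S (k + 1)"
      using index newton by metis
  next
    fix k assume k: "k \<in> {3 .. int CARD('n) - 1}"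
      and ne: "\<not> ((\<forall>i j. x $ i = x $ j)
            \<or> ((S k)\<^sup>2 = 0 \<and> S (k - 1) * S (k + 1) = 0)
            \<or> (S (k - 1) \<noteq> 0 \<and> S k \<noteq> 0
               \<and> S k / S (k - 1) = S (k + 1) / S k
               \<and> (S (k + 1) / S k = - \<alpha> \<or> S (k + 1) / S k = - \<beta>)))"
    obtain i where i: "i + 4 \<le> CARD('n)"
      and S: "S (k - 1) = s i" "S k = s (i + 1)" "S (k + 1) = s (i + 2)"
      using index[OF k] by blast
    show "(S k)\<^sup>2 > S (k - 1) * S (k + 1)"
      unfolding S by (rule strict[OF i]) (use ne[unfolded S] in blast)+
  next
    fix k m assume "k \<in> {2 .. CARD('n)}" "m \<in> {1 ..< k}"
      and "\<alpha> \<ge> 0 \<and> \<beta> \<ge> 0 \<and> E 1 \<ge> 0 \<and> E 2 \<ge> 0 \<and> (\<forall>m \<in> {3 .. k}. S (int m) \<ge> 0)"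
    then show "root m (S (int m)) \<ge> root (m + 1) (S (int (m + 1)))"
      unfolding S_def E_def by (intro lin_mean_root_chain[of \<alpha> \<beta> x k m]) auto
  qed
qed

end
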